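(* Let $V_n=\mathbb{C}[[t]]/(t^{n+1})$, $\mathfrak{N}=e^t-1\in V_n$ (so $\mathfrak{N}^{n+1}=0$), and let $M(n)$ be the arithmetic cost of a product in $V_n$. Computing all Stirling numbers of the second kind $S(n,k)$ for $k=1,\dots,n$ through the powers of $\mathfrak{N}$ in $V_n$ costs $$O(n\cdot M(n))=O(n^2\log n)$$ arithmetic operations, compared to the classical cost $\Theta(n^2)$ of the triangular recurrence $S(n,k)=k\,S(n-1,k)+S(n-1,k-1)$. (Thus the operational cost is greater than the classical cost, and there is no improvement over the triangular recurrence in this case.)
   Context: Costs are scalar arithmetic operations in the arithmetic circuit model, with $M(n)=O(n\log n)$. The numbers $S(n,k)$ are read off from the powers of $\mathfrak{N}$ as coefficients of $t^n$ in $\frac{1}{k!}(e^t-1)^k$, up to the normalization of exponential generating functions, $\frac{1}{k!}(e^t-1)^k=\sum_{n\ge k}S(n,k)\,t^n/n!$. *)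

theory Defs
  imports
    Complex_Main
    "HOL-Computational_Algebra.Formal_Power_Series"
    "HOL-Combinatorics.Stirling"
    "HOL-Library.Landau_Symbols"
    "HOL-Library.State_Monad"
begin

text \<open>
  A circuit is a straight-line program. The wires are numbered: the inputs come first, and every
  gate appends one new wire. Evaluation is undefined if a gate reads a wire that does not exist yet
  or divides by zero, so neither unspecified list entries nor the convention \<open>x / 0 = 0\<close> can be
  exploited. Scalars are free; every addition, subtraction, multiplication and division costs one.
\<close>

datatype 'w gate =
  is_Const: Const complex | Add 'w 'w | Sub 'w 'w | Mul 'w 'w | Div 'w 'w

fun apply_gate :: "complex gate \<Rightarrow> complex option" where
  "apply_gate (Const c) = Some c"
| "apply_gate (Add x y) = Some (x + y)"
| "apply_gate (Sub x y) = Some (x - y)"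
| "apply_gate (Mul x y) = Some (x * y)"
| "apply_gate (Div x y) = (if y = 0 then None else Some (x / y))"

definition eval_gate :: "complex list \<Rightarrow> nat gate \<Rightarrow> complex option" where
  "eval_gate ws g =
     (if \<forall>i\<in>set_gate g. i < length ws then apply_gate (map_gate ((!) ws) g) else None)"

primrec run_gates :: "nat gate list \<Rightarrow> complex list \<Rightarrow> complex list option" where
  "run_gates [] ws = Some ws"
| "run_gates (g # gs) ws =
     (case eval_gate ws g of None \<Rightarrow> None | Some v \<Rightarrow> run_gates gs (ws @ [v]))"

datatype circuit = Circuit (gates: "nat gate list") (outputs: "nat list")

definition eval_circuit :: "circuit \<Rightarrow> complex list \<Rightarrow> complex list option" where
  "eval_circuit C xs =
     (case run_gates (gates C) xs of
        None \<Rightarrow> None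
      | Some ws \<Rightarrow>
          if \<forall>i\<in>set (outputs C). i < length ws then Some (map ((!) ws) (outputs C)) else None)"

definition circuit_cost :: "circuit \<Rightarrow> nat" where
  "circuit_cost C = length (filter (\<lambda>g. \<not> is_Const g) (gates C))"

text \<open>
  The class of a power series \<open>f\<close> in \<open>V\<^sub>n = \<complex>[[t]] / (t\<^sup>n\<^sup>+\<^sup>1)\<close> is represented by its coordinates in the basis
  \<open>1, t, \<dots>, t\<^sup>n\<close>.
\<close>

definition coords :: "nat \<Rightarrow> complex fps \<Rightarrow> complex list" where
  "coords n f = map (fps_nth f) [0..<Suc n]"

definition product_circuit :: "nat \<Rightarrow> circuit \<Rightarrow> bool" where
  "product_circuit n C \<longleftrightarrow>
     (\<forall>f g. eval_circuit C (coords n f @ coords n g) = Some (coords n (f * g)))"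

definition product_cost :: "nat \<Rightarrow> nat" where
  "product_cost n = (LEAST c. \<exists>C. product_circuit n C \<and> circuit_cost C = c)"

definition nilp :: "complex fps" where
  "nilp = fps_exp 1 - 1"

text \<open>
  Builders are for circuits without inputs, so a wire is the position of its gate. The state is the
  list of gates emitted so far.
\<close>

type_synonym 'a builder = "(nat gate list, 'a) state"

definition emit :: "nat gate \<Rightarrow> nat builder" where
  "emit g = State (\<lambda>gs. (length gs, gs @ [g]))"

primrec collect :: "('a \<Rightarrow> 'b builder) \<Rightarrow> 'a list \<Rightarrow> 'b list builder" where
  "collect f [] = State_Monad.return []"
| "collect f (x # xs) = do {
     y \<leftarrow> f x;
     ys \<leftarrow> collect f xs;
     State_Monad.return (y # ys)
   }"

text \<open>Here \<open>\<rho> ! i\<close> is the new name of wire \<open>i\<close> of the circuit that is being copied.\<close>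

primrec inline :: "nat gate list \<Rightarrow> nat list \<Rightarrow> nat list builder" where
  "inline [] \<rho> = State_Monad.return \<rho>"
| "inline (g # gs) \<rho> = do {
     w \<leftarrow> emit (map_gate ((!) \<rho>) g);
     inline gs (\<rho> @ [w])
   }"

definition call :: "circuit \<Rightarrow> nat list \<Rightarrow> nat list builder" where
  "call C args = do {
     \<rho> \<leftarrow> inline (gates C) args;
     State_Monad.return (map ((!) \<rho>) (outputs C))
   }"

definition build :: "nat list builder \<Rightarrow> circuit" where
  "build m = (case run_state m [] of (ws, gs) \<Rightarrow> Circuit gs ws)"

text \<open>\<open>inverse_factorials w j m\<close>: from \<open>w = 1/j!\<close> compute \<open>1/(j+1)!, \<dots>, 1/(j+m)!\<close>.\<close>

primrec inverse_factorials :: "nat \<Rightarrow> nat \<Rightarrow> nat \<Rightarrow> nat list builder" where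
  "inverse_factorials w j 0 = State_Monad.return []"
| "inverse_factorials w j (Suc m) = do {
     c \<leftarrow> emit (Const (of_nat (Suc j)));
     v \<leftarrow> emit (Div w c);
     vs \<leftarrow> inverse_factorials v (Suc j) m;
     State_Monad.return (v # vs)
   }"

text \<open>\<open>power_chain mul N P m\<close>: the coordinates of \<open>P N, P N\<^sup>2, \<dots>, P N\<^sup>m\<close>, with one product each.\<close>

primrec power_chain :: "circuit \<Rightarrow> nat list \<Rightarrow> nat list \<Rightarrow> nat \<Rightarrow> nat list list builder" where
  "power_chain mul N P 0 = State_Monad.return []"
| "power_chain mul N P (Suc m) = do {
     Q \<leftarrow> call mul (P @ N);
     Qs \<leftarrow> power_chain mul N Q m;
     State_Monad.return (Q # Qs)
   }"

text \<open>
  With \<open>mul\<close> a product circuit for \<open>V\<^sub>n\<close>, the \<open>k\<close>-th output is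
  \<open>n! \<cdot> (1/k! \<cdot> [t\<^sup>n] (e\<^sup>t - 1)\<^sup>k)\<close> for \<open>k = 1, \<dots>, n\<close>. Entry \<open>j\<close> of \<open>inv\<close> is \<open>1/j!\<close>, and entry \<open>k - 1\<close>
  of \<open>Ps\<close> holds the coordinates of the \<open>k\<close>-th power.
\<close>

definition stirling_by_powers :: "circuit \<Rightarrow> nat \<Rightarrow> circuit" where
  "stirling_by_powers mul n = build (do {
     zero \<leftarrow> emit (Const 0);
     one \<leftarrow> emit (Const 1);
     vs \<leftarrow> inverse_factorials one 0 n;
     let inv = one # vs;
     let N = zero # vs;
     Qs \<leftarrow> power_chain mul N N (n - 1);
     let Ps = N # Qs;
     nfact \<leftarrow> emit (Div one (inv ! n));
     collect (\<lambda>k. do {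
       c \<leftarrow> emit (Mul (inv ! k) (Ps ! (k - 1) ! n));
       emit (Mul nfact c)
     }) [1..<Suc n]
   })"

text \<open>
  From the row \<open>S(m,0), \<dots>, S(m,m)\<close> compute \<open>S(m+1,k) = k S(m,k) + S(m,k-1)\<close> for
  \<open>k = 1, \<dots>, m+1\<close>, where \<open>S(m,m+1) = 0\<close>; the leading entry \<open>S(m+1,0)\<close> is \<open>0\<close>.
\<close>

definition next_row :: "nat \<Rightarrow> nat \<Rightarrow> nat list \<Rightarrow> nat list builder" where
  "next_row zero m row = do {
     ws \<leftarrow> collect (\<lambda>k. do {
       c \<leftarrow> emit (Const (of_nat k));
       p \<leftarrow> emit (Mul c ((row @ [zero]) ! k));
       emit (Add p (row ! (k - 1)))
     }) [1..<m + 2];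
     State_Monad.return (zero # ws)
   }"

primrec triangle_row :: "nat \<Rightarrow> nat \<Rightarrow> nat \<Rightarrow> nat list builder" where
  "triangle_row zero one 0 = State_Monad.return [one]"
| "triangle_row zero one (Suc m) = do {
     row \<leftarrow> triangle_row zero one m;
     next_row zero m row
   }"

definition stirling_by_recurrence :: "nat \<Rightarrow> circuit" where
  "stirling_by_recurrence n = build (do {
     zero \<leftarrow> emit (Const 0);
     one \<leftarrow> emit (Const 1);
     row \<leftarrow> triangle_row zero one n;
     State_Monad.return (tl row)
   })"

definition stirling_numbers :: "nat \<Rightarrow> complex list" where
  "stirling_numbers n = map (\<lambda>k. of_nat (Stirling n k)) [1..<Suc n]"

end

theory Submission
  imports Defs "HOL-Computational_Algebra.Polynomial"
begin

text \<open>
  The generating function identity comes from \<open>N' = N + 1\<close> for \<open>N = e\<^sup>t - 1\<close>: differentiating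
  \<open>N\<^sup>k\<close> gives \<open>k (N\<^sup>k + N\<^sup>k\<^sup>-\<^sup>1)\<close>, and on coefficients this is the recurrence of the Stirling numbers
  (\<open>nilp_power_nth\<close>).

  Both algorithms are checked with a program logic for builders, the judgement \<open>yields\<close>, which
  follows the values on the wires and counts the charged gates at the same time. It yields the exact
  costs \<open>3n + 1 + (n - 1) P(n)\<close> for the powers and \<open>n (n + 1)\<close> for the triangular recurrence, where
  \<open>P(n)\<close> is the cost of a product (\<open>stirling_by_powers_correct\<close>, \<open>stirling_by_recurrence_correct\<close>).
  What remains are two bounds for \<open>P(n)\<close>.

  Below, \<open>P(n) \<ge> n + 1\<close> (\<open>product_circuit_cost_ge\<close>): the \<open>n + 1\<close> coordinates of a product are pairwise
  distinct functions of the factors, and none of them is an input or a constant, so each needs a charged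
  gate of its own. With this bound \<open>(n - 1) P(n) \<ge> n\<^sup>2 - 1\<close>, so the powers always cost more than the
  recurrence.

  Above, \<open>P(n) = O(n log n)\<close> (\<open>product_cost_bigo\<close>): the factors are polynomials of degree at most \<open>n\<close>,
  so for \<open>2\<^sup>m > 2n\<close> their product is recovered from its values at the \<open>2\<^sup>m\<close>-th roots of unity. The fast
  Fourier transform evaluates with \<open>O(m 2\<^sup>m)\<close> operations. Each of its butterflies is an invertible linear
  map, so running the network backwards interpolates at a cost of the same order
  (\<open>obtainable_dft\<close>, \<open>obtainable_inverse_dft\<close>).

  For the Fourier transform no wires are renamed. A program only ever grows, and it is described by the
  set of functions of the input that appear on its wires. Subcircuits then compose by taking unions
  of such sets.
\<close>

section \<open>Powers of the exponential series\<close>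

lemma coords_nilp_power: "coords n (nilp ^ Suc n) = coords n 0"
proof -
  have "fps_nth (nilp ^ Suc n) j = 0" if "j < Suc n" for j
    by (rule startsby_zero_power_prefix[rule_format, OF _ that]) (simp add: nilp_def)
  then show ?thesis
    by (simp add: coords_def del: power_Suc)
qed

lemma fps_deriv_nilp_power:
  "fps_deriv (nilp ^ Suc k) = of_nat (Suc k) * (nilp ^ Suc k + nilp ^ k)"
proof -
  have "fps_deriv nilp = nilp + 1"
    by (simp add: nilp_def)
  then show ?thesis
    by (simp add: fps_deriv_power fps_of_nat algebra_simps del: of_nat_Suc power_Suc) (simp add: algebra_simps)
qed

text \<open>
  The coefficient of \<open>t\<^sup>n\<close> in the derivative of \<open>N\<^sup>k\<close> is \<open>(n + 1) [t\<^sup>n\<^sup>+\<^sup>1] N\<^sup>k\<close>, so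
  \<open>fps_deriv_nilp_power\<close> turns into the recurrence \<open>S(n+1, k+1) = (k+1) S(n, k+1) + S(n, k)\<close>.
\<close>

lemma nilp_power_nth: "fps_nth (nilp ^ k) n = fact k * of_nat (Stirling n k) / fact n"
proof (induction n arbitrary: k)
  case 0
  show ?case by (cases k) (simp_all add: nilp_def)
next
  case (Suc n)
  show ?case
  proof (cases k)
    case 0
    then show ?thesis by simp
  next
    case (Suc k')
    have "of_nat (Suc n) * fps_nth (nilp ^ Suc k') (Suc n) = fps_nth (fps_deriv (nilp ^ Suc k')) n"
      by (simp del: power_Suc)
    also have "\<dots> = of_nat (Suc k') * (fps_nth (nilp ^ Suc k') n + fps_nth (nilp ^ k') n)"
      by (simp only: fps_deriv_nilp_power fps_mult_of_nat_nth fps_add_nth)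
    also have "\<dots> = fact (Suc k') * of_nat (Stirling (Suc n) (Suc k')) / fact n"
      by (simp only: Suc.IH) (simp add: field_simps)
    finally have "fps_nth (nilp ^ Suc k') (Suc n)
        = fact (Suc k') * of_nat (Stirling (Suc n) (Suc k')) / fact n / of_nat (Suc n)"
      by (simp only: nonzero_eq_divide_eq of_nat_eq_0_iff nat.distinct mult.commute not_False_eq_True)
    then show ?thesis using Suc by (simp add: mult.commute del: power_Suc Stirling.simps of_nat_Suc)
  qed
qed

lemma stirling_egf:
  "Abs_fps (\<lambda>n. of_nat (Stirling n k) / fact n) = fps_const (1 / fact k) * nilp ^ k"
  by (simp add: fps_eq_iff nilp_power_nth)

section \<open>Wires and the execution of gates\<close>

definition carries :: "complex list \<Rightarrow> nat \<Rightarrow> complex \<Rightarrow> bool" where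
  "carries ws i v \<longleftrightarrow> i < length ws \<and> ws ! i = v"

definition gate_cost :: "nat gate list \<Rightarrow> nat" where
  "gate_cost gs = length (filter (\<lambda>g. \<not> is_Const g) gs)"

lemma gate_cost_simps [simp]:
  "gate_cost [] = 0"
  "gate_cost (g # gs) = (if is_Const g then 0 else 1) + gate_cost gs"
  "gate_cost (gs @ hs) = gate_cost gs + gate_cost hs"
  by (simp_all add: gate_cost_def)

lemma circuit_cost_Circuit [simp]: "circuit_cost (Circuit gs os) = gate_cost gs"
  by (simp add: circuit_cost_def gate_cost_def)

lemma run_gates_append:
  "run_gates (gs @ hs) ws = Option.bind (run_gates gs ws) (run_gates hs)"
  by (induction gs arbitrary: ws) (auto split: option.splits)

lemma run_gates_extends:
  "run_gates gs ws = Some ws' \<Longrightarrow> \<exists>vs. ws' = ws @ vs \<and> length vs = length gs"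
  by (induction gs arbitrary: ws) (force split: option.splits)+

lemma run_gates_length: "run_gates gs ws = Some ws' \<Longrightarrow> length ws' = length ws + length gs"
  using run_gates_extends by fastforce

lemma carries_append: "carries ws i v \<Longrightarrow> carries (ws @ vs) i v"
  by (simp add: carries_def nth_append)

lemma carries_last [simp]: "carries (ws @ [v]) (length ws) v"
  by (simp add: carries_def)

lemma list_all2_carries_append:
  "list_all2 (carries ws) ids xs \<Longrightarrow> list_all2 (carries (ws @ vs)) ids xs"
  by (erule list_all2_mono) (rule carries_append)

text \<open>
  Moving a gate to other wires does not change its value as long as the new wires carry the values that
  the gate expects. Inlining a circuit and appending a gate to a program both reduce to this fact; \<open>val\<close>
  gives the value expected for each name \<open>x\<close>.
\<close>

lemma eval_gate_carries:
  assumes "\<And>x. x \<in> set_gate g \<Longrightarrow> carries ws (idx x) (val x)"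
  shows "eval_gate ws (map_gate idx g) = apply_gate (map_gate val g)"
proof -
  have "map_gate ((!) ws \<circ> idx) g = map_gate val g"
    using assms by (auto simp: carries_def intro!: gate.map_cong)
  with assms show ?thesis
    by (auto simp: eval_gate_def carries_def gate.set_map gate.map_comp)
qed

lemma nth_coords [simp]: "i \<le> n \<Longrightarrow> coords n f ! i = fps_nth f i"
  by (simp add: coords_def del: upt_Suc)

lemma length_coords [simp]: "length (coords n f) = Suc n"
  by (simp add: coords_def)

section \<open>Correctness and cost of circuit builders\<close>

text \<open>
  A Hoare triple for builders: started after gates that produced the values \<open>ws\<close>, the builder only
  appends gates, these run without error at a cost of \<open>c\<close>, and \<open>R\<close> relates the result to the new list of
  values. The old values stay in place, so facts about them survive by \<open>carries_append\<close>.
\<close>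

definition yields ::
  "'a builder \<Rightarrow> complex list \<Rightarrow> ('a \<Rightarrow> complex list \<Rightarrow> bool) \<Rightarrow> nat \<Rightarrow> bool" where
  "yields m ws R c \<longleftrightarrow>
     (\<forall>gs. run_gates gs [] = Some ws \<longrightarrow>
        (\<exists>y hs vs. run_state m gs = (y, gs @ hs) \<and> run_gates (gs @ hs) [] = Some (ws @ vs) \<and>
           R y (ws @ vs) \<and> gate_cost hs = c))"

lemma yields_return: "R y ws \<Longrightarrow> yields (State_Monad.return y) ws R 0"
  by (auto simp: yields_def)

lemma yields_bind:
  assumes m: "yields m ws Q c"
    and f: "\<And>y vs. Q y (ws @ vs) \<Longrightarrow> yields (f y) (ws @ vs) R d"
    and e: "e = c + d"
  shows "yields (State_Monad.bind m f) ws R e"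
  unfolding yields_def
proof (intro allI impI)
  fix gs
  assume "run_gates gs [] = Some ws"
  with m obtain y hs vs where 1: "run_state m gs = (y, gs @ hs)"
      "run_gates (gs @ hs) [] = Some (ws @ vs)" "Q y (ws @ vs)" "gate_cost hs = c"
    unfolding yields_def by blast
  with f[OF 1(3)] obtain z hs' vs' where 2: "run_state (f y) (gs @ hs) = (z, (gs @ hs) @ hs')"
      "run_gates ((gs @ hs) @ hs') [] = Some ((ws @ vs) @ vs')" "R z ((ws @ vs) @ vs')"
      "gate_cost hs' = d"
    unfolding yields_def by blast
  show "\<exists>y hs vs. run_state (State_Monad.bind m f) gs = (y, gs @ hs) \<and>
      run_gates (gs @ hs) [] = Some (ws @ vs) \<and> R y (ws @ vs) \<and> gate_cost hs = e"
    by (rule exI[of _ z], rule exI[of _ "hs @ hs'"], rule exI[of _ "vs @ vs'"])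
      (use 1 2 e in simp)
qed

lemma yields_emit:
  assumes "\<And>i. i \<in> set_gate g \<Longrightarrow> carries ws i (val i)"
    and "apply_gate (map_gate val g) = Some v"
    and "c = (if is_Const g then 0 else 1)"
  shows "yields (emit g) ws (\<lambda>i ws'. carries ws' i v) c"
proof -
  have "eval_gate ws g = Some v"
    using eval_gate_carries[of g ws "\<lambda>i. i" val] assms by (simp add: gate.map_ident)
  moreover have "length gs = length ws" if "run_gates gs [] = Some ws" for gs
    using run_gates_length[OF that] by simp
  ultimately show ?thesis
    using assms(3) by (auto simp: yields_def emit_def run_gates_append)
qed

lemma yields_emit_Const: "yields (emit (Const v)) ws (\<lambda>i ws'. carries ws' i v) 0"
  by (rule yields_emit) simp_all

lemma yields_emit_binary:
  assumes "carries ws i x" "carries ws j y"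
  shows "yields (emit (Add i j)) ws (\<lambda>k ws'. carries ws' k (x + y)) 1"
    and "yields (emit (Mul i j)) ws (\<lambda>k ws'. carries ws' k (x * y)) 1"
    and "y \<noteq> 0 \<Longrightarrow> yields (emit (Div i j)) ws (\<lambda>k ws'. carries ws' k (x / y)) 1"
  by (rule yields_emit[where val = "\<lambda>k. ws ! k"]; use assms in \<open>force simp: carries_def\<close>)+

lemma yields_collect:
  assumes "\<And>x vs. x \<in> set xs \<Longrightarrow> yields (f x) (ws @ vs) (\<lambda>i ws'. carries ws' i (h x)) c"
  shows "yields (collect f xs) ws (\<lambda>ids ws'. list_all2 (carries ws') ids (map h xs)) (length xs * c)"
  using assms
proof (induction xs arbitrary: ws)
  case Nil
  show ?case by (auto intro: yields_return)
next
  case (Cons x xs)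
  show ?case
    unfolding collect.simps
  proof (rule yields_bind)
    show "yields (f x) ws (\<lambda>i ws'. carries ws' i (h x)) c"
      using Cons.prems[of x "[]"] by simp
  next
    fix i vs
    assume i: "carries (ws @ vs) i (h x)"
    show "yields (State_Monad.bind (collect f xs) (\<lambda>ids. State_Monad.return (i # ids))) (ws @ vs)
        (\<lambda>ids ws'. list_all2 (carries ws') ids (map h (x # xs))) (length xs * c)"
    proof (rule yields_bind)
      show "yields (collect f xs) (ws @ vs)
          (\<lambda>ids ws'. list_all2 (carries ws') ids (map h xs)) (length xs * c)"
        using Cons.prems by (intro Cons.IH) simp
    qed (use carries_append[OF i] in \<open>auto intro!: yields_return\<close>)
  qed simp
qed

text \<open>
  The copied gates run in lockstep with the original ones: at every point the renaming \<open>\<rho>\<close> sends wire \<open>i\<close>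
  of the original to a wire that carries the same value.
\<close>

lemma yields_inline:
  assumes "list_all2 (carries ws) \<rho> xs" "run_gates gs xs = Some ys"
  shows "yields (inline gs \<rho>) ws (\<lambda>\<rho>' ws'. list_all2 (carries ws') \<rho>' ys) (gate_cost gs)"
  using assms
proof (induction gs arbitrary: ws \<rho> xs)
  case Nil
  then show ?case by (auto intro: yields_return)
next
  case (Cons g gs)
  then obtain v where v: "eval_gate xs g = Some v" and ys: "run_gates gs (xs @ [v]) = Some ys"
    by (auto split: option.splits)
  from v have bound: "\<And>i. i \<in> set_gate g \<Longrightarrow> i < length xs"
    and app: "apply_gate (map_gate ((!) xs) g) = Some v"
    by (auto simp: eval_gate_def split: if_splits)
  have car: "\<And>i. i < length xs \<Longrightarrow> carries ws (\<rho> ! i) (xs ! i)"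
    using Cons.prems(1) by (auto simp: list_all2_conv_all_nth)
  have "eval_gate ws (map_gate ((!) \<rho>) g) = Some v"
    using eval_gate_carries[of g ws "(!) \<rho>" "(!) xs"] bound car app by simp
  then have step: "yields (emit (map_gate ((!) \<rho>) g)) ws (\<lambda>i ws'. carries ws' i v)
      (if is_Const g then 0 else 1)"
    by (intro yields_emit[where val = "(!) ws"])
      (auto simp: eval_gate_def carries_def gate.map_disc_iff split: if_splits)
  show ?case
    unfolding inline.simps
  proof (rule yields_bind[OF step])
    fix i vs
    assume "carries (ws @ vs) i v"
    then have "list_all2 (carries (ws @ vs)) (\<rho> @ [i]) (xs @ [v])"
      using list_all2_carries_append[OF Cons.prems(1)] by (simp add: list_all2_appendI)
    then show "yields (inline gs (\<rho> @ [i])) (ws @ vs)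
        (\<lambda>\<rho>' ws'. list_all2 (carries ws') \<rho>' ys) (gate_cost gs)"
      using ys by (rule Cons.IH)
  qed simp
qed

lemma yields_call:
  assumes "list_all2 (carries ws) args xs" "eval_circuit C xs = Some ys"
  shows "yields (call C args) ws (\<lambda>ids ws'. list_all2 (carries ws') ids ys) (circuit_cost C)"
proof -
  obtain zs where zs: "run_gates (gates C) xs = Some zs" "\<And>i. i \<in> set (outputs C) \<Longrightarrow> i < length zs"
    and ys: "ys = map ((!) zs) (outputs C)"
    using assms(2) by (auto simp: eval_circuit_def split: option.splits if_splits)
  show ?thesis
    unfolding call_def
  proof (rule yields_bind[OF yields_inline[OF assms(1) zs(1)]])
    show "circuit_cost C = gate_cost (gates C) + 0"
      by (simp add: circuit_cost_def gate_cost_def)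
  qed (auto simp: ys list_all2_conv_all_nth zs(2) intro!: yields_return)
qed

lemma build_yields:
  assumes "yields m [] (\<lambda>ids ws. list_all2 (carries ws) ids vs) c"
  shows "eval_circuit (build m) [] = Some vs" and "circuit_cost (build m) = c"
proof -
  obtain ids hs ws where m: "run_state m [] = (ids, hs)" "run_gates hs [] = Some ws"
      "list_all2 (carries ws) ids vs" "gate_cost hs = c"
    using assms unfolding yields_def by force
  from m(3) have "(\<forall>i\<in>set ids. i < length ws) \<and> map ((!) ws) ids = vs"
    by (auto simp: list_all2_conv_all_nth carries_def in_set_conv_nth intro!: nth_equalityI)
  with m show "eval_circuit (build m) [] = Some vs" "circuit_cost (build m) = c"
    by (simp_all add: build_def eval_circuit_def)
qed

section \<open>The two circuits for the Stirling numbers\<close>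

lemma yields_inverse_factorials:
  assumes "carries ws w (1 / fact j)"
  shows "yields (inverse_factorials w j m) ws
    (\<lambda>ids ws'. list_all2 (carries ws') ids (map (\<lambda>i. 1 / fact i) [Suc j..<Suc j + m])) m"
  using assms
proof (induction m arbitrary: ws w j)
  case 0
  show ?case by (auto intro: yields_return)
next
  case (Suc m)
  show ?case
    unfolding inverse_factorials.simps
  proof (rule yields_bind[OF yields_emit_Const])
    fix c vs
    assume c: "carries (ws @ vs) c (of_nat (Suc j))"
    have quot: "1 / fact j / of_nat (Suc j) = (1 / fact (Suc j) :: complex)"
      by (simp add: field_simps)
    have "yields (emit (Div w c)) (ws @ vs) (\<lambda>k ws'. carries ws' k (1 / fact j / of_nat (Suc j))) 1"
      by (rule yields_emit_binary(3)[OF carries_append[OF Suc.prems] c]) (simp del: of_nat_Suc)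
    then show "yields (State_Monad.bind (emit (Div w c)) (\<lambda>v. State_Monad.bind (inverse_factorials v (Suc j) m)
        (\<lambda>vs. State_Monad.return (v # vs)))) (ws @ vs)
      (\<lambda>ids ws'. list_all2 (carries ws') ids (map (\<lambda>i. 1 / fact i) [Suc j..<Suc j + Suc m])) (Suc m)"
      unfolding quot
    proof (rule yields_bind)
      fix v us
      assume v: "carries ((ws @ vs) @ us) v (1 / fact (Suc j))"
      show "yields (State_Monad.bind (inverse_factorials v (Suc j) m)
          (\<lambda>vs. State_Monad.return (v # vs))) ((ws @ vs) @ us)
        (\<lambda>ids ws'. list_all2 (carries ws') ids (map (\<lambda>i. 1 / fact i) [Suc j..<Suc j + Suc m])) m"
      proof (rule yields_bind[OF Suc.IH[OF v]])
        show "m = m + 0" by simp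
      next
        fix ids xs
        assume "list_all2 (carries (((ws @ vs) @ us) @ xs)) ids
          (map (\<lambda>i. 1 / fact i) [Suc (Suc j)..<Suc (Suc j) + m])"
        moreover have "[Suc j..<Suc j + Suc m] = Suc j # [Suc (Suc j)..<Suc (Suc j) + m]"
          by (subst upt_conv_Cons) simp_all
        ultimately show "yields (State_Monad.return (v # ids)) (((ws @ vs) @ us) @ xs)
          (\<lambda>ids ws'. list_all2 (carries ws') ids
            (map (\<lambda>i. 1 / fact i) [Suc j..<Suc j + Suc m])) 0"
          using carries_append[OF v, of xs] by (intro yields_return) (simp only: list.map list_all2_Cons)
      qed
    qed simp
  qed simp
qed

lemma yields_power_chain:
  assumes C: "product_circuit n C"
    and N: "list_all2 (carries ws) N (coords n f)"
    and P: "list_all2 (carries ws) P (coords n p)"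
  shows "yields (power_chain C N P m) ws
    (\<lambda>Qs ws'. length Qs = m \<and> (\<forall>i<m. list_all2 (carries ws') (Qs ! i) (coords n (p * f ^ Suc i))))
    (m * circuit_cost C)"
  using N P
proof (induction m arbitrary: ws P p)
  case 0
  show ?case by (auto intro: yields_return)
next
  case (Suc m)
  have call: "yields (call C (P @ N)) ws
      (\<lambda>ids ws'. list_all2 (carries ws') ids (coords n (p * f))) (circuit_cost C)"
    using C Suc.prems by (intro yields_call) (auto intro: list_all2_appendI simp: product_circuit_def)
  show ?case
    unfolding power_chain.simps
  proof (rule yields_bind[OF call])
    fix Q vs
    assume Q: "list_all2 (carries (ws @ vs)) Q (coords n (p * f))"
    show "yields (State_Monad.bind (power_chain C N Q m) (\<lambda>Qs. State_Monad.return (Q # Qs))) (ws @ vs)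
      (\<lambda>Qs ws'. length Qs = Suc m \<and>
        (\<forall>i<Suc m. list_all2 (carries ws') (Qs ! i) (coords n (p * f ^ Suc i)))) (m * circuit_cost C)"
    proof (rule yields_bind[OF Suc.IH[OF list_all2_carries_append[OF Suc.prems(1)] Q]])
      fix Qs us
      assume "length Qs = m \<and>
        (\<forall>i<m. list_all2 (carries ((ws @ vs) @ us)) (Qs ! i) (coords n (p * f * f ^ Suc i)))"
      then show "yields (State_Monad.return (Q # Qs)) ((ws @ vs) @ us)
        (\<lambda>Qs ws'. length Qs = Suc m \<and>
          (\<forall>i<Suc m. list_all2 (carries ws') (Qs ! i) (coords n (p * f ^ Suc i)))) 0"
        using list_all2_carries_append[OF Q, of us]
        by (intro yields_return) (auto simp: less_Suc_eq_0_disj mult.assoc)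
    qed simp
  qed simp
qed

text \<open>
  The final stage computes \<open>n! \<cdot> (1/k! \<cdot> [t\<^sup>n] N\<^sup>k)\<close>, which is \<open>S(n,k)\<close> by \<open>nilp_power_nth\<close>. It needs \<open>n!\<close>,
  obtained as the inverse of \<open>1/n!\<close>, and two multiplications for each \<open>k\<close>.
\<close>

lemma yields_stirling_outputs:
  assumes one: "carries ws one 1"
    and invs: "\<And>k. k \<le> n \<Longrightarrow> carries ws (invs ! k) (1 / fact k)"
    and Ps: "\<And>k. k \<in> {1..n} \<Longrightarrow> carries ws (Ps ! (k - 1) ! n) (fps_nth (nilp ^ k) n)"
  shows "yields (do {
      nfact \<leftarrow> emit (Div one (invs ! n));
      collect (\<lambda>k. do {
        c \<leftarrow> emit (Mul (invs ! k) (Ps ! (k - 1) ! n));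
        emit (Mul nfact c)
      }) [1..<Suc n]
    }) ws (\<lambda>ids ws'. list_all2 (carries ws') ids (stirling_numbers n)) (1 + n * 2)"
proof (rule yields_bind)
  show "yields (emit (Div one (invs ! n))) ws (\<lambda>k ws'. carries ws' k (1 / (1 / fact n))) 1"
    using one invs by (intro yields_emit_binary) auto
next
  fix nfact vs
  assume nfact: "carries (ws @ vs) nfact (1 / (1 / fact n))"
  have "yields (collect (\<lambda>k. do {
        c \<leftarrow> emit (Mul (invs ! k) (Ps ! (k - 1) ! n));
        emit (Mul nfact c)
      }) [1..<Suc n]) (ws @ vs)
      (\<lambda>ids ws'. list_all2 (carries ws') ids (map (\<lambda>k. of_nat (Stirling n k)) [1..<Suc n]))
      (length [1..<Suc n] * 2)"
  proof (rule yields_collect)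
    fix k us
    assume k: "k \<in> set [1..<Suc n]"
    show "yields (do {
        c \<leftarrow> emit (Mul (invs ! k) (Ps ! (k - 1) ! n));
        emit (Mul nfact c)
      }) ((ws @ vs) @ us) (\<lambda>i ws'. carries ws' i (of_nat (Stirling n k))) 2"
    proof (rule yields_bind)
      show "yields (emit (Mul (invs ! k) (Ps ! (k - 1) ! n))) ((ws @ vs) @ us)
          (\<lambda>i ws'. carries ws' i (1 / fact k * fps_nth (nilp ^ k) n)) 1"
        using k by (intro yields_emit_binary carries_append invs Ps) auto
    next
      fix c xs
      assume c: "carries (((ws @ vs) @ us) @ xs) c (1 / fact k * fps_nth (nilp ^ k) n)"
      have "yields (emit (Mul nfact c)) (((ws @ vs) @ us) @ xs)
          (\<lambda>i ws'. carries ws' i (1 / (1 / fact n) * (1 / fact k * fps_nth (nilp ^ k) n))) 1"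
        by (intro yields_emit_binary carries_append nfact c)
      then show "yields (emit (Mul nfact c)) (((ws @ vs) @ us) @ xs)
          (\<lambda>i ws'. carries ws' i (of_nat (Stirling n k))) 1"
        by (simp add: nilp_power_nth)
    qed simp
  qed
  then show "yields (collect (\<lambda>k. do {
        c \<leftarrow> emit (Mul (invs ! k) (Ps ! (k - 1) ! n));
        emit (Mul nfact c)
      }) [1..<Suc n]) (ws @ vs)
      (\<lambda>ids ws'. list_all2 (carries ws') ids (stirling_numbers n)) (n * 2)"
    by (simp add: stirling_numbers_def del: upt_Suc)
qed simp

text \<open>
  The cost consists of \<open>n\<close> divisions for the inverse factorials, \<open>n - 1\<close> products for the powers, one
  division for \<open>n!\<close> and \<open>2n\<close> multiplications for the outputs. Since \<open>N\<close> has the coefficients \<open>0\<close> and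
  \<open>1/j!\<close>, its coordinates need no operations of their own.
\<close>

lemma stirling_by_powers_correct:
  assumes C: "product_circuit n C"
  shows "eval_circuit (stirling_by_powers C n) [] = Some (stirling_numbers n)"
    and "circuit_cost (stirling_by_powers C n) = 3 * n + 1 + (n - 1) * circuit_cost C"
proof -
  note [simp del] = upt_Suc
  let ?c = "(n - 1) * circuit_cost C + (1 + n * 2)"
  have "yields (do {
     zero \<leftarrow> emit (Const 0);
     one \<leftarrow> emit (Const 1);
     vs \<leftarrow> inverse_factorials one 0 n;
     let inv = one # vs;
     let N = zero # vs;
     Qs \<leftarrow> power_chain C N N (n - 1);
     let Ps = N # Qs;
     nfact \<leftarrow> emit (Div one (inv ! n));
     collect (\<lambda>k. do {
       c \<leftarrow> emit (Mul (inv ! k) (Ps ! (k - 1) ! n));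
       emit (Mul nfact c)
     }) [1..<Suc n]
   }) [] (\<lambda>ids ws. list_all2 (carries ws) ids (stirling_numbers n)) (n + ?c)"
    unfolding Let_def
  proof (rule yields_bind[OF yields_emit_Const], rule yields_bind[OF yields_emit_Const],
      rule yields_bind[OF yields_inverse_factorials])
    fix zero ws1 one ws2 vs ws3
    assume zero: "carries ([] @ ws1) zero 0" and one: "carries (([] @ ws1) @ ws2) one 1"
    show "carries (([] @ ws1) @ ws2) one (1 / fact 0)"
      using one by simp
    assume vs: "list_all2 (carries ((([] @ ws1) @ ws2) @ ws3)) vs (map (\<lambda>i. 1 / fact i) [Suc 0..<Suc 0 + n])"
    let ?ws = "(([] @ ws1) @ ws2) @ ws3"
    have split: "[0..<Suc n] = 0 # [Suc 0..<Suc 0 + n]"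
      by (subst upt_conv_Cons) simp_all
    have N: "list_all2 (carries ?ws) (zero # vs) (coords n nilp)"
    proof -
      have "coords n nilp = 0 # map (\<lambda>i. 1 / fact i) [Suc 0..<Suc 0 + n]"
        by (simp add: coords_def nilp_def split)
      then show ?thesis
        using vs zero by (simp add: carries_append)
    qed
    show "yields (do {
        Qs \<leftarrow> power_chain C (zero # vs) (zero # vs) (n - 1);
        nfact \<leftarrow> emit (Div one ((one # vs) ! n));
        collect (\<lambda>k. do {
          c \<leftarrow> emit (Mul ((one # vs) ! k) (((zero # vs) # Qs) ! (k - 1) ! n));
          emit (Mul nfact c)
        }) [1..<Suc n]
      }) ?ws (\<lambda>ids ws. list_all2 (carries ws) ids (stirling_numbers n)) ?c"
    proof (rule yields_bind[OF yields_power_chain[OF C N N]], rule yields_stirling_outputs)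
      fix Qs ws4
      assume Qs: "length Qs = n - 1 \<and>
        (\<forall>i<n - 1. list_all2 (carries (?ws @ ws4)) (Qs ! i) (coords n (nilp * nilp ^ Suc i)))"
      show "carries (?ws @ ws4) one 1"
        using one by (blast intro: carries_append)
      have "list_all2 (carries ?ws) (one # vs) (map (\<lambda>i. 1 / fact i) [0..<Suc n])"
        using vs carries_append[OF one, of ws3] by (simp add: split)
      then show "carries (?ws @ ws4) ((one # vs) ! k) (1 / fact k)" if "k \<le> n" for k
        using that by (intro carries_append[of ?ws]) (auto simp: list_all2_conv_all_nth)
      show "carries (?ws @ ws4) (((zero # vs) # Qs) ! (k - 1) ! n) (fps_nth (nilp ^ k) n)"
        if "k \<in> {1..n}" for k
      proof -
        have "list_all2 (carries (?ws @ ws4)) (((zero # vs) # Qs) ! (k - 1)) (coords n (nilp ^ k))"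
        proof (cases "k = 1")
          case True
          then show ?thesis
            using list_all2_carries_append[OF N] by simp
        next
          case False
          \<comment> \<open>The powers in \<open>Qs\<close> start with \<open>N\<^sup>2\<close>, hence the shift by two.\<close>
          with that obtain j where "k = Suc (Suc j)" "j < n - 1"
            by (intro that[of "k - 2"]) auto
          then show ?thesis
            using Qs by simp
        qed
        from list_all2_nthD2[OF this, of n] show ?thesis
          by simp
      qed
    qed simp
  qed simp_all
  from build_yields[OF this] show "eval_circuit (stirling_by_powers C n) [] = Some (stirling_numbers n)"
      "circuit_cost (stirling_by_powers C n) = 3 * n + 1 + (n - 1) * circuit_cost C"
    by (simp_all add: stirling_by_powers_def)
qed

text \<open>
  The row is padded by \<open>S(m,m+1) = 0\<close>, so that the recurrence applies uniformly to \<open>k = 1, \<dots>, m+1\<close> with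
  one multiplication and one addition each.
\<close>

lemma yields_next_row:
  assumes zero: "carries ws zero 0"
    and row: "list_all2 (carries ws) row (map (\<lambda>k. of_nat (Stirling m k)) [0..<Suc m])"
  shows "yields (next_row zero m row) ws
    (\<lambda>ids ws'. list_all2 (carries ws') ids (map (\<lambda>k. of_nat (Stirling (Suc m) k)) [0..<Suc (Suc m)]))
    (2 * Suc m)"
proof -
  note [simp del] = upt_Suc
  have len: "length row = Suc m"
    using list_all2_lengthD[OF row] by simp
  have entry: "carries ws (row ! k) (of_nat (Stirling m k))" if "k \<le> m" for k
    using list_all2_nthD2[OF row, of k] that by simp
  have padded: "carries ws ((row @ [zero]) ! k) (of_nat (Stirling m k))" if "k \<le> Suc m" for k
    using that entry[of k] zero by (cases "k = Suc m") (auto simp: nth_append len)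
  have "yields (collect (\<lambda>k. do {
       c \<leftarrow> emit (Const (of_nat k));
       p \<leftarrow> emit (Mul c ((row @ [zero]) ! k));
       emit (Add p (row ! (k - 1)))
     }) [1..<m + 2]) ws
    (\<lambda>ids ws'. list_all2 (carries ws') ids (map (\<lambda>k. of_nat (Stirling (Suc m) k)) [1..<m + 2]))
    (length [1..<m + 2] * 2)"
  proof (rule yields_collect)
    fix k vs
    assume k: "k \<in> set [1..<m + 2]"
    then have "Suc (k - 1) = k"
      by simp
    then have rec: "Stirling (Suc m) k = k * Stirling m k + Stirling m (k - 1)"
      using Stirling.simps(4)[of m "k - 1"] by simp
    show "yields (do {
       c \<leftarrow> emit (Const (of_nat k));
       p \<leftarrow> emit (Mul c ((row @ [zero]) ! k));
       emit (Add p (row ! (k - 1)))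
     }) (ws @ vs) (\<lambda>i ws'. carries ws' i (of_nat (Stirling (Suc m) k))) 2"
    proof (rule yields_bind[OF yields_emit_Const], rule yields_bind)
      fix c us
      assume c: "carries ((ws @ vs) @ us) c (of_nat k)"
      have "carries ((ws @ vs) @ us) ((row @ [zero]) ! k) (of_nat (Stirling m k))"
        using k by (intro carries_append padded) simp
      with c show "yields (emit (Mul c ((row @ [zero]) ! k))) ((ws @ vs) @ us)
          (\<lambda>i ws'. carries ws' i (of_nat k * of_nat (Stirling m k))) 1"
        by (rule yields_emit_binary)
    next
      fix c us p xs
      assume p: "carries (((ws @ vs) @ us) @ xs) p (of_nat k * of_nat (Stirling m k))"
      have "carries (((ws @ vs) @ us) @ xs) (row ! (k - 1)) (of_nat (Stirling m (k - 1)))"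
        using k by (intro carries_append entry) auto
      with p have "yields (emit (Add p (row ! (k - 1)))) (((ws @ vs) @ us) @ xs)
          (\<lambda>i ws'. carries ws' i (of_nat k * of_nat (Stirling m k) + of_nat (Stirling m (k - 1)))) 1"
        by (rule yields_emit_binary)
      then show "yields (emit (Add p (row ! (k - 1)))) (((ws @ vs) @ us) @ xs)
          (\<lambda>i ws'. carries ws' i (of_nat (Stirling (Suc m) k))) 1"
        by (simp add: rec del: Stirling.simps)
    qed simp_all
  qed
  then show ?thesis
    unfolding next_row_def
  proof (rule yields_bind)
    fix ids vs
    assume "list_all2 (carries (ws @ vs)) ids (map (\<lambda>k. of_nat (Stirling (Suc m) k)) [1..<m + 2])"
    moreover have "[0..<Suc (Suc m)] = 0 # [1..<m + 2]"
      by (subst upt_conv_Cons) simp_all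
    ultimately show "yields (State_Monad.return (zero # ids)) (ws @ vs)
      (\<lambda>ids ws'. list_all2 (carries ws') ids
        (map (\<lambda>k. of_nat (Stirling (Suc m) k)) [0..<Suc (Suc m)])) 0"
      using carries_append[OF zero] by (intro yields_return) simp
  qed simp
qed

lemma yields_triangle_row:
  assumes "carries ws zero 0" "carries ws one 1"
  shows "yields (triangle_row zero one m) ws
    (\<lambda>ids ws'. list_all2 (carries ws') ids (map (\<lambda>k. of_nat (Stirling m k)) [0..<Suc m]))
    (m * Suc m)"
proof (induction m)
  case 0
  show ?case using assms by (auto intro: yields_return)
next
  case (Suc m)
  show ?case
    unfolding triangle_row.simps
    by (rule yields_bind[OF Suc.IH], rule yields_next_row[OF carries_append[OF assms(1)]]) auto
qed

lemma stirling_by_recurrence_correct: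
  shows "eval_circuit (stirling_by_recurrence n) [] = Some (stirling_numbers n)"
    and "circuit_cost (stirling_by_recurrence n) = n * Suc n"
proof -
  have "yields (do {
     zero \<leftarrow> emit (Const 0);
     one \<leftarrow> emit (Const 1);
     row \<leftarrow> triangle_row zero one n;
     State_Monad.return (tl row)
   }) [] (\<lambda>ids ws. list_all2 (carries ws) ids (stirling_numbers n)) (n * Suc n)"
  proof (rule yields_bind[OF yields_emit_Const], rule yields_bind[OF yields_emit_Const],
      rule yields_bind[OF yields_triangle_row])
    fix zero ws1 one ws2 row ws3
    assume row: "list_all2 (carries ((([] @ ws1) @ ws2) @ ws3)) row
        (map (\<lambda>k. of_nat (Stirling n k)) [0..<Suc n])"
    have "[0..<Suc n] = 0 # [1..<Suc n]"
      by (subst upt_conv_Cons) simp_all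
    with row show "yields (State_Monad.return (tl row)) ((([] @ ws1) @ ws2) @ ws3)
        (\<lambda>ids ws. list_all2 (carries ws) ids (stirling_numbers n)) 0"
      by (intro yields_return)
        (auto simp: stirling_numbers_def list_all2_Cons2 simp del: upt_Suc)
  qed (auto intro: carries_append)
  from build_yields[OF this] show "eval_circuit (stirling_by_recurrence n) [] = Some (stirling_numbers n)"
      "circuit_cost (stirling_by_recurrence n) = n * Suc n"
    by (simp_all add: stirling_by_recurrence_def)
qed

section \<open>A lower bound for the cost of a product\<close>

lemma run_gates_nth:
  assumes "run_gates gs ws = Some ws'" "i < length gs"
  shows "\<exists>us. eval_gate us (gs ! i) = Some (ws' ! (length ws + i))"
  using assms
proof (induction gs arbitrary: ws i)
  case (Cons g gs)
  then obtain v where v: "eval_gate ws g = Some v" and gs: "run_gates gs (ws @ [v]) = Some ws'"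
    by (auto split: option.splits)
  show ?case
  proof (cases i)
    case 0
    with v run_gates_extends[OF gs] show ?thesis
      by (auto simp: nth_append)
  next
    case (Suc j)
    with Cons.IH[OF gs, of j] Cons.prems(2) show ?thesis
      by simp
  qed
qed simp

lemma gate_cost_eq_card: "gate_cost gs = card {i. i < length gs \<and> \<not> is_Const (gs ! i)}"
  by (simp add: gate_cost_def length_filter_conv_card)

text \<open>
  The \<open>n + 1\<close> outputs of a product circuit are \<open>(f, g) \<mapsto> [t\<^sup>k] (f g)\<close> for \<open>k \<le> n\<close>. Substituting \<open>0\<close>, \<open>1\<close>
  and \<open>t\<^sup>k\<close> for the factors shows that these functions are not constant, do not coincide with a
  coordinate of one factor, and are pairwise distinct. Hence they sit on distinct gate wires, and none of
  these gates is a constant.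
\<close>

lemma product_circuit_cost_ge:
  assumes C: "product_circuit n C"
  shows "n < circuit_cost C"
proof -
  let ?in = "\<lambda>f g. coords n f @ coords n g"
  let ?gs = "gates C" and ?os = "outputs C"
  have run: "\<exists>ws. run_gates ?gs (?in f g) = Some ws \<and> length ws = 2 * Suc n + length ?gs \<and>
      (\<forall>i\<in>set ?os. i < length ws) \<and> map ((!) ws) ?os = coords n (f * g)" for f g
  proof -
    from C have "eval_circuit C (?in f g) = Some (coords n (f * g))"
      by (simp add: product_circuit_def)
    then show ?thesis
      by (auto simp: eval_circuit_def dest: run_gates_length split: option.splits if_splits)
  qed
  have "length ?os = Suc n"
    using run[of 0 0] by (auto dest: arg_cong[where f = length])
  have out: "\<exists>ws. run_gates ?gs (?in f g) = Some ws \<and> length ws = 2 * Suc n + length ?gs \<and>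
      ?os ! k < length ws \<and> ws ! (?os ! k) = fps_nth (f * g) k" if "k \<le> n" for f g k
  proof -
    obtain ws where ws: "run_gates ?gs (?in f g) = Some ws" "length ws = 2 * Suc n + length ?gs"
      "\<forall>i\<in>set ?os. i < length ws" "map ((!) ws) ?os = coords n (f * g)"
      using run by blast
    have "map ((!) ws) ?os ! k = fps_nth (f * g) k"
      using that by (simp add: ws(4))
    then have "ws ! (?os ! k) = fps_nth (f * g) k"
      using that \<open>length ?os = Suc n\<close> by simp
    with ws that \<open>length ?os = Suc n\<close> show ?thesis
      by auto
  qed
  have not_input: "2 * Suc n \<le> ?os ! k" if k: "k \<le> n" for k
  proof (rule ccontr)
    assume "\<not> 2 * Suc n \<le> ?os ! k"
    then have less: "?os ! k < length (?in f g)" for f g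
      by simp
    have wire: "?in f g ! (?os ! k) = fps_nth (f * g) k" for f g
    proof -
      obtain ws where ws: "run_gates ?gs (?in f g) = Some ws" "ws ! (?os ! k) = fps_nth (f * g) k"
        using out[OF k] by blast
      from run_gates_extends[OF ws(1)] obtain vs where "ws = ?in f g @ vs"
        by blast
      with ws(2) less[of f g] show ?thesis
        by (simp only: nth_append if_True)
    qed
    show False
    \<comment> \<open>A wire of the first factor ignores the second factor, and conversely.\<close>
    proof (cases "?os ! k \<le> n")
      case True
      then have "fps_nth 1 (?os ! k) = fps_nth g k" for g :: "complex fps"
        using wire[of 1 g] by (simp add: nth_append)
      from this[of 0] this[of "fps_X ^ k"] show False
        by simp
    next
      case False
      then have "?os ! k - Suc n \<le> n" "\<not> ?os ! k < Suc n"
        using less[of 0 0] by auto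
      then have "fps_nth 1 (?os ! k - Suc n) = fps_nth f k" for f :: "complex fps"
        using wire[of f 1] by (simp add: nth_append)
      from this[of 0] this[of "fps_X ^ k"] show False
        by simp
    qed
  qed
  let ?pos = "\<lambda>k. ?os ! k - 2 * Suc n"
  have "?pos ` {..n} \<subseteq> {i. i < length ?gs \<and> \<not> is_Const (?gs ! i)}"
  proof (intro image_subsetI CollectI conjI notI)
    fix k
    assume "k \<in> {..n}"
    then have k: "k \<le> n" by simp
    show less: "?pos k < length ?gs"
      using out[OF k, of 0 0] not_input[OF k] by auto
    assume const: "is_Const (?gs ! ?pos k)"
    then obtain c where c: "?gs ! ?pos k = Const c"
      by (cases "?gs ! ?pos k") auto
    \<comment> \<open>A constant gate gives the same output for all factors, but \<open>0 \<cdot> 0\<close> and \<open>1 \<cdot> t\<^sup>k\<close> differ at \<open>k\<close>.\<close>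
    have "fps_nth (f * g) k = c" for f g
    proof -
      obtain ws where ws: "run_gates ?gs (?in f g) = Some ws" "ws ! (?os ! k) = fps_nth (f * g) k"
        using out[OF k] by blast
      have "length (?in f g) + ?pos k = ?os ! k"
        using not_input[OF k] by simp
      with run_gates_nth[OF ws(1) less] ws(2) obtain us
        where "eval_gate us (Const c) = Some (fps_nth (f * g) k)"
        by (metis c)
      then show ?thesis
        by (simp add: eval_gate_def)
    qed
    from this[of 0 0] this[of 1 "fps_X ^ k"] show False
      by simp
  qed
  moreover have "inj_on ?pos {..n}"
  proof (rule inj_onI)
    fix j k
    assume jk: "j \<in> {..n}" "k \<in> {..n}" "?pos j = ?pos k"
    then have "?os ! j = ?os ! k"
      using not_input[of j] not_input[of k] by auto
    then have "fps_nth (1 * fps_X ^ j) j = (fps_nth (1 * fps_X ^ j) k :: complex)"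
      using out[of j 1 "fps_X ^ j"] out[of k 1 "fps_X ^ j"] jk by (auto simp del: mult_1 fps_X_power_nth)
    then show "j = k"
      by (cases "j = k") simp_all
  qed
  ultimately have "card {..n} \<le> card {i. i < length ?gs \<and> \<not> is_Const (?gs ! i)}"
    by (intro card_inj_on_le) auto
  then show ?thesis
    by (simp add: circuit_cost_def flip: gate_cost_def gate_cost_eq_card)
qed

section \<open>Functions computed by growing programs\<close>

text \<open>
  An element \<open>e\<close> of \<open>'e\<close> is a problem instance and \<open>inp e\<close> its encoding on the input wires. A value
  computed from it is a function of \<open>e\<close>. The gates and the wire of each function are the same for
  all instances, as they must be in a circuit.
\<close>

definition computed :: "('e \<Rightarrow> complex list) \<Rightarrow> nat \<Rightarrow> ('e \<Rightarrow> complex) set \<Rightarrow> bool" where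
  "computed inp c S \<longleftrightarrow>
     (\<exists>gs run. gate_cost gs \<le> c \<and> (\<forall>e. run_gates gs (inp e) = Some (run e)) \<and>
        (\<forall>h\<in>S. \<exists>i. \<forall>e. carries (run e) i (h e)))"

lemma computed_inputs:
  assumes "\<And>h. h \<in> S \<Longrightarrow> \<exists>i. \<forall>e. carries (inp e) i (h e)"
  shows "computed inp 0 S"
  unfolding computed_def
  by (rule exI[of _ "[]"], rule exI[of _ inp]) (use assms in simp)

lemma computed_mono: "computed inp c S \<Longrightarrow> T \<subseteq> S \<Longrightarrow> c \<le> d \<Longrightarrow> computed inp d T"
  unfolding computed_def by (meson le_trans subsetD)

text \<open>
  The gate \<open>g\<close> has functions in place of wires. Replacing each function by a wire that carries it gives an
  actual gate. The assumption on the length of the inputs ensures that the new wire has the same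
  number for all instances.
\<close>

lemma computed_gate:
  assumes len: "\<And>e. length (inp e) = k"
    and S: "computed inp c S" "set_gate g \<subseteq> S"
    and v: "\<And>e. apply_gate (map_gate (\<lambda>h. h e) g) = Some (v e)"
  shows "computed inp (c + (if is_Const g then 0 else 1)) (insert v S)"
proof -
  obtain gs run where c: "gate_cost gs \<le> c" and run: "\<And>e. run_gates gs (inp e) = Some (run e)"
    and "\<forall>h\<in>S. \<exists>i. \<forall>e. carries (run e) i (h e)"
    using S(1) unfolding computed_def by blast
  then obtain idx where idx: "\<And>h e. h \<in> S \<Longrightarrow> carries (run e) (idx h) (h e)"
    by metis
  let ?g = "map_gate idx g" and ?run = "\<lambda>e. run e @ [v e]"
  have len_run: "length (run e) = k + length gs" for e
    using run_gates_length[OF run] len by simp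
  have "eval_gate (run e) ?g = Some (v e)" for e
    using eval_gate_carries[of g "run e" idx "\<lambda>h. h e"] idx S(2) v by auto
  then have "run_gates (gs @ [?g]) (inp e) = Some (?run e)" for e
    by (simp add: run_gates_append run)
  moreover have "\<exists>i. \<forall>e. carries (?run e) i (h e)" if "h \<in> insert v S" for h
  proof (cases "h = v")
    case True
    then show ?thesis
      by (intro exI[of _ "k + length gs"] allI) (simp add: carries_def len_run nth_append)
  next
    case False
    with that show ?thesis
      using idx by (blast intro: carries_append)
  qed
  moreover have "gate_cost (gs @ [?g]) \<le> c + (if is_Const g then 0 else 1)"
    using c by (simp add: gate.map_disc_iff)
  ultimately show ?thesis
    unfolding computed_def by (intro exI[of _ "gs @ [?g]"] exI[of _ ?run]) blast
qed

text \<open>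
  Any program that already computes \<open>S\<close> extends to one that also computes \<open>T\<close>, at an extra cost of at most
  \<open>d\<close>. The quantification over all larger sets \<open>S'\<close> makes this relation monotone and composable: a step
  does not care about, and does not destroy, what else has been computed.
\<close>

definition obtainable ::
  "('e \<Rightarrow> complex list) \<Rightarrow> ('e \<Rightarrow> complex) set \<Rightarrow> nat \<Rightarrow> ('e \<Rightarrow> complex) set \<Rightarrow> bool" where
  "obtainable inp S d T \<longleftrightarrow>
     (\<forall>c S'. S \<subseteq> S' \<longrightarrow> computed inp c S' \<longrightarrow> computed inp (c + d) (S' \<union> T))"

lemma obtainable_subset: "T \<subseteq> S \<Longrightarrow> obtainable inp S 0 T"
  by (auto simp: obtainable_def intro: computed_mono)

lemma obtainable_mono:
  assumes "obtainable inp S d T" "S \<subseteq> S'" "T' \<subseteq> T" "d \<le> d'"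
  shows "obtainable inp S' d' T'"
  unfolding obtainable_def
proof (intro allI impI)
  fix c R
  assume "S' \<subseteq> R" "computed inp c R"
  with assms(1,2) have "computed inp (c + d) (R \<union> T)"
    unfolding obtainable_def by blast
  then show "computed inp (c + d') (R \<union> T')"
    by (rule computed_mono) (use assms(3,4) in auto)
qed

lemma obtainable_trans:
  assumes "obtainable inp S d T" "obtainable inp (S \<union> T) d' U" "e = d + d'"
  shows "obtainable inp S e (T \<union> U)"
  unfolding obtainable_def
proof (intro allI impI)
  fix c R
  assume R: "S \<subseteq> R" "computed inp c R"
  with assms(1) have "computed inp (c + d) (R \<union> T)"
    unfolding obtainable_def by blast
  moreover have "S \<union> T \<subseteq> R \<union> T"
    using R by blast
  ultimately have "computed inp (c + d + d') (R \<union> T \<union> U)"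
    using assms(2) unfolding obtainable_def by blast
  then show "computed inp (c + e) (R \<union> (T \<union> U))"
    by (simp add: assms(3) Un_assoc add.assoc)
qed

lemma obtainable_cut:
  assumes "obtainable inp S d T" "obtainable inp T d' U"
  shows "obtainable inp S (d + d') U"
proof -
  have "obtainable inp (S \<union> T) d' U"
    using assms(2) by (rule obtainable_mono) auto
  from obtainable_trans[OF assms(1) this refl] show ?thesis
    by (rule obtainable_mono) auto
qed

lemma obtainable_Un:
  assumes "obtainable inp S d T" "obtainable inp S d' U" "e = d + d'"
  shows "obtainable inp S e (T \<union> U)"
  by (rule obtainable_trans[OF assms(1) _ assms(3)]) (rule obtainable_mono[OF assms(2)], auto)

lemma obtainable_UN:
  assumes "\<And>k. k < N \<Longrightarrow> obtainable inp S d (T k)"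
  shows "obtainable inp S (N * d) (\<Union>k<N. T k)"
  using assms
proof (induction N)
  case 0
  show ?case by (simp add: obtainable_subset)
next
  case (Suc N)
  then have "obtainable inp S (N * d) (\<Union>k<N. T k)" "obtainable inp S d (T N)"
    by simp_all
  from obtainable_Un[OF this refl] show ?case
    by (simp add: lessThan_Suc Un_commute add.commute)
qed

lemma obtainable_gate:
  assumes len: "\<And>e. length (inp e) = k"
    and "set_gate g \<subseteq> S" "\<And>e. apply_gate (map_gate (\<lambda>h. h e) g) = Some (v e)"
    and "d = (if is_Const g then 0 else 1)"
  shows "obtainable inp S d {v}"
  unfolding obtainable_def
proof (intro allI impI)
  fix c R
  assume "S \<subseteq> R" "computed inp c R"
  with assms(2) have "computed inp (c + d) (insert v R)"
    unfolding assms(4) by (intro computed_gate[OF len _ _ assms(3)]) auto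
  then show "computed inp (c + d) (R \<union> {v})"
    by simp
qed

lemma obtainable_arith:
  assumes len: "\<And>e. length (inp e) = k" and xy: "x \<in> S" "y \<in> S"
  shows "obtainable inp S 0 {\<lambda>e. c}"
    and "obtainable inp S 1 {\<lambda>e. x e + y e}"
    and "obtainable inp S 1 {\<lambda>e. x e - y e}"
    and "obtainable inp S 1 {\<lambda>e. x e * y e}"
  using obtainable_gate[OF len, of "Const c" S "\<lambda>e. c"] obtainable_gate[OF len, of "Add x y" S]
    obtainable_gate[OF len, of "Sub x y" S] obtainable_gate[OF len, of "Mul x y" S] xy
  by simp_all

lemma obtainable_scale:
  assumes len: "\<And>e. length (inp e) = k" and x: "x \<in> S"
  shows "obtainable inp S 1 {\<lambda>e. c * x e}"
proof -
  have "obtainable inp S 1 ({\<lambda>e. c} \<union> {\<lambda>e. c * x e})"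
    by (rule obtainable_trans[OF obtainable_arith(1)[OF len x x] obtainable_arith(4)[OF len]])
      (use x in auto)
  then show ?thesis
    by (rule obtainable_mono) auto
qed

section \<open>The fast Fourier transform\<close>

text \<open>
  The values at \<open>1, \<omega>, \<omega>\<^sup>2, \<dots>\<close> of the polynomial with \<open>2\<^sup>m\<close> coefficients \<open>a\<close>.
\<close>

definition dft :: "nat \<Rightarrow> complex \<Rightarrow> (nat \<Rightarrow> 'e \<Rightarrow> complex) \<Rightarrow> nat \<Rightarrow> 'e \<Rightarrow> complex" where
  "dft m \<omega> a k = (\<lambda>e. \<Sum>j<2 ^ m. a j e * \<omega> ^ (j * k))"

lemma sum_even_odd:
  fixes f :: "nat \<Rightarrow> complex"
  shows "(\<Sum>j<2 * N. f j) = (\<Sum>j<N. f (2 * j)) + (\<Sum>j<N. f (2 * j + 1))"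
  by (induction N) (simp_all add: algebra_simps)

text \<open>
  Split the polynomial into even and odd part, \<open>p(x) = p\<^sub>0(x\<^sup>2) + x p\<^sub>1(x\<^sup>2)\<close>. As \<open>\<omega>\<close> to the power \<open>2\<^sup>m\<close> is \<open>-1\<close>,
  the points with the exponents \<open>k\<close> and \<open>k + 2\<^sup>m\<close> are opposite, have the same square and share both parts.
\<close>

lemma dft_butterfly:
  assumes "\<omega> ^ 2 ^ m = - 1"
  shows "dft (Suc m) \<omega> a k e = dft m (\<omega>\<^sup>2) (\<lambda>j. a (2 * j)) k e + \<omega> ^ k * dft m (\<omega>\<^sup>2) (\<lambda>j. a (2 * j + 1)) k e"
    and "dft (Suc m) \<omega> a (k + 2 ^ m) e = dft m (\<omega>\<^sup>2) (\<lambda>j. a (2 * j)) k e - \<omega> ^ k * dft m (\<omega>\<^sup>2) (\<lambda>j. a (2 * j + 1)) k e"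
proof -
  show "dft (Suc m) \<omega> a k e = dft m (\<omega>\<^sup>2) (\<lambda>j. a (2 * j)) k e + \<omega> ^ k * dft m (\<omega>\<^sup>2) (\<lambda>j. a (2 * j + 1)) k e"
    by (simp add: dft_def sum_even_odd sum_distrib_left algebra_simps
        power_add flip: power_mult)
  have "\<omega> ^ (2 * j * (k + 2 ^ m)) = (\<omega>\<^sup>2) ^ (j * k)" for j
  proof -
    have "\<omega> ^ (2 * j * (k + 2 ^ m)) = \<omega> ^ (2 * (j * k)) * (\<omega> ^ 2 ^ m) ^ (2 * j)"
      by (simp add: algebra_simps flip: power_mult power_add)
    then show ?thesis
      by (simp add: assms(1) power_mult)
  qed
  moreover have "\<omega> ^ ((2 * j + 1) * (k + 2 ^ m)) = - (\<omega> ^ k * (\<omega>\<^sup>2) ^ (j * k))" for j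
  proof -
    have "\<omega> ^ ((2 * j + 1) * (k + 2 ^ m)) = \<omega> ^ k * \<omega> ^ (2 * (j * k)) * (\<omega> ^ 2 ^ m) ^ (2 * j + 1)"
      by (simp add: algebra_simps flip: power_mult power_add)
    then show ?thesis
      by (simp add: assms(1) power_mult)
  qed
  ultimately show "dft (Suc m) \<omega> a (k + 2 ^ m) e = dft m (\<omega>\<^sup>2) (\<lambda>j. a (2 * j)) k e - \<omega> ^ k * dft m (\<omega>\<^sup>2) (\<lambda>j. a (2 * j + 1)) k e"
    by (simp only: dft_def sum_even_odd power_Suc)
      (simp add: sum_distrib_left sum_negf algebra_simps)
qed

lemma lessThan_double: "{..<2 ^ Suc m} = {..<2 ^ m} \<union> (\<lambda>k. k + 2 ^ m) ` {..<(2::nat) ^ m}"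
proof (intro equalityI subsetI)
  fix x :: nat
  assume "x \<in> {..<2 ^ Suc m}"
  then show "x \<in> {..<2 ^ m} \<union> (\<lambda>k. k + 2 ^ m) ` {..<(2::nat) ^ m}"
    by (cases "x < 2 ^ m") (auto intro!: image_eqI[of _ _ "x - 2 ^ m"])
qed auto

lemma lessThan_double_parity:
  "{..<2 ^ Suc m} = (\<lambda>j. 2 * j) ` {..<2 ^ m} \<union> (\<lambda>j. 2 * j + 1) ` {..<(2::nat) ^ m}"
proof (intro equalityI subsetI)
  fix x :: nat
  assume "x \<in> {..<2 ^ Suc m}"
  then show "x \<in> (\<lambda>j. 2 * j) ` {..<2 ^ m} \<union> (\<lambda>j. 2 * j + 1) ` {..<(2::nat) ^ m}"
    by (cases "even x") (auto elim!: evenE oddE)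
qed auto

text \<open>
  Each butterfly takes one multiplication by a root of unity, one addition and one subtraction. There are
  \<open>2\<^sup>m\<close> of them for the step from \<open>m\<close> to \<open>m + 1\<close>, and \<open>4m 2\<^sup>m + 3 \<cdot> 2\<^sup>m \<le> 2 (m + 1) 2\<^sup>m\<^sup>+\<^sup>1\<close>. For \<open>m > 0\<close>
  the condition on \<open>\<omega>\<close> says that it is a primitive \<open>2\<^sup>m\<close>-th root of unity; it passes to \<open>\<omega>\<^sup>2\<close> and \<open>m - 1\<close>.
\<close>

lemma obtainable_dft:
  assumes len: "\<And>e. length (inp e) = n"
    and "\<And>l. m = Suc l \<Longrightarrow> \<omega> ^ 2 ^ l = - 1"
  shows "obtainable inp (a ` {..<2 ^ m}) (2 * m * 2 ^ m) (dft m \<omega> a ` {..<2 ^ m})"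
  using assms(2)
proof (induction m arbitrary: \<omega> a)
  case 0
  have "dft 0 \<omega> a 0 = a 0"
    by (simp add: dft_def)
  then show ?case
    by (auto intro: obtainable_subset)
next
  case (Suc m)
  define E where "E = dft m (\<omega>\<^sup>2) (\<lambda>j. a (2 * j))"
  define F where "F = dft m (\<omega>\<^sup>2) (\<lambda>j. a (2 * j + 1))"
  let ?N = "2 ^ m :: nat"
  have \<omega>: "\<omega> ^ 2 ^ m = - 1"
    using Suc.prems by simp
  have root: "(\<omega>\<^sup>2) ^ 2 ^ l = - 1" if "m = Suc l" for l
    using \<omega> that by (simp flip: power_mult)
  have "obtainable inp (a ` {..<2 ^ Suc m}) (2 * m * ?N) (E ` {..<?N})"
    unfolding E_def by (rule obtainable_mono[OF Suc.IH[OF root]]) (auto simp: lessThan_double_parity)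
  moreover have "obtainable inp (a ` {..<2 ^ Suc m}) (2 * m * ?N) (F ` {..<?N})"
    unfolding F_def by (rule obtainable_mono[OF Suc.IH[OF root]]) (auto simp: lessThan_double_parity)
  ultimately have halves: "obtainable inp (a ` {..<2 ^ Suc m}) (2 * m * ?N + 2 * m * ?N)
      (E ` {..<?N} \<union> F ` {..<?N})"
    by (rule obtainable_Un) simp
  let ?S = "a ` {..<2 ^ Suc m} \<union> (E ` {..<?N} \<union> F ` {..<?N})"
  let ?T = "\<lambda>k. {dft (Suc m) \<omega> a k, dft (Suc m) \<omega> a (k + ?N)}"
  have "obtainable inp ?S 3 (?T k)" if k: "k < ?N" for k
  proof -
    let ?t = "\<lambda>e. \<omega> ^ k * F k e"
    have "obtainable inp ?S 1 {?t}"
      using k by (intro obtainable_scale[OF len]) auto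
    moreover have "obtainable inp (?S \<union> {?t}) 2 ({\<lambda>e. E k e + ?t e} \<union> {\<lambda>e. E k e - ?t e})"
      using k by (intro obtainable_Un[OF obtainable_arith(2,3)[OF len]]) auto
    ultimately have "obtainable inp ?S 3 ({?t} \<union> ({\<lambda>e. E k e + ?t e} \<union> {\<lambda>e. E k e - ?t e}))"
      by (rule obtainable_trans) simp
    then show ?thesis
    proof (rule obtainable_mono)
      show "?T k \<subseteq> {?t} \<union> ({\<lambda>e. E k e + ?t e} \<union> {\<lambda>e. E k e - ?t e})"
        using dft_butterfly[OF \<omega>, of a k] by (auto simp: E_def F_def fun_eq_iff)
    qed auto
  qed
  from obtainable_UN[OF this] have "obtainable inp ?S (?N * 3) (\<Union>k<?N. ?T k)" .
  have sub: "dft (Suc m) \<omega> a ` {..<2 ^ Suc m} \<subseteq> E ` {..<?N} \<union> F ` {..<?N} \<union> (\<Union>k<?N. ?T k)"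
    unfolding lessThan_double image_Un image_image by blast
  have cost: "2 * m * ?N + 2 * m * ?N + ?N * 3 \<le> 2 * Suc m * 2 ^ Suc m"
    by (simp add: algebra_simps)
  from obtainable_trans[OF halves \<open>obtainable inp ?S (?N * 3) (\<Union>k<?N. ?T k)\<close> refl] show ?case
    using sub cost by (rule obtainable_mono[OF _ subset_refl])
qed

text \<open>
  The butterflies are solved for the even and the odd half: half the sum of the two values is the
  former, and half their difference divided by \<open>\<omega>\<^sup>k\<close> is the latter. This takes four operations per
  butterfly, since the division by \<open>2 \<omega>\<^sup>k\<close> is a multiplication by a constant.
\<close>

lemma obtainable_inverse_dft:
  assumes len: "\<And>e. length (inp e) = n"
    and "\<And>l. m = Suc l \<Longrightarrow> \<omega> ^ 2 ^ l = - 1"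
  shows "obtainable inp (dft m \<omega> a ` {..<2 ^ m}) (2 * m * 2 ^ m) (a ` {..<2 ^ m})"
  using assms(2)
proof (induction m arbitrary: \<omega> a)
  case 0
  have "dft 0 \<omega> a 0 = a 0"
    by (simp add: dft_def)
  then show ?case
    by (auto intro: obtainable_subset)
next
  case (Suc m)
  define E where "E = dft m (\<omega>\<^sup>2) (\<lambda>j. a (2 * j))"
  define F where "F = dft m (\<omega>\<^sup>2) (\<lambda>j. a (2 * j + 1))"
  let ?N = "2 ^ m :: nat"
  have \<omega>: "\<omega> ^ 2 ^ m = - 1"
    using Suc.prems by simp
  then have "\<omega> \<noteq> 0"
    by (auto simp: power_0_left)
  have root: "(\<omega>\<^sup>2) ^ 2 ^ l = - 1" if "m = Suc l" for l
    using \<omega> that by (simp flip: power_mult)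
  let ?S = "dft (Suc m) \<omega> a ` {..<2 ^ Suc m}"
  have "obtainable inp ?S 4 {E k, F k}" if k: "k < ?N" for k
  proof -
    let ?x = "dft (Suc m) \<omega> a k" and ?y = "dft (Suc m) \<omega> a (k + ?N)"
    let ?s = "\<lambda>e. ?x e + ?y e" and ?d = "\<lambda>e. ?x e - ?y e"
    have "?x \<in> ?S" "?y \<in> ?S"
      using k by auto
    then have "obtainable inp ?S 2 ({?s} \<union> {?d})"
      by (intro obtainable_Un[OF obtainable_arith(2,3)[OF len]]) auto
    moreover have "obtainable inp (?S \<union> ({?s} \<union> {?d})) 2
        ({\<lambda>e. 1 / 2 * ?s e} \<union> {\<lambda>e. 1 / (2 * \<omega> ^ k) * ?d e})"
      by (intro obtainable_Un[OF obtainable_scale[OF len] obtainable_scale[OF len]]) auto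
    ultimately have "obtainable inp ?S 4
        (({?s} \<union> {?d}) \<union> ({\<lambda>e. 1 / 2 * ?s e} \<union> {\<lambda>e. 1 / (2 * \<omega> ^ k) * ?d e}))"
      by (rule obtainable_trans) simp
    then show ?thesis
    proof (rule obtainable_mono)
      have "E k = (\<lambda>e. 1 / 2 * ?s e)" "F k = (\<lambda>e. 1 / (2 * \<omega> ^ k) * ?d e)"
        using dft_butterfly[OF \<omega>, of a k] \<open>\<omega> \<noteq> 0\<close> by (auto simp: E_def F_def fun_eq_iff)
      then show "{E k, F k} \<subseteq>
          ({?s} \<union> {?d}) \<union> ({\<lambda>e. 1 / 2 * ?s e} \<union> {\<lambda>e. 1 / (2 * \<omega> ^ k) * ?d e})"
        by blast
    qed auto
  qed
  from obtainable_UN[OF this]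
  have halves: "obtainable inp ?S (?N * 4) (\<Union>k<?N. {E k, F k})" .
  let ?R = "?S \<union> (\<Union>k<?N. {E k, F k})"
  have "obtainable inp ?R (2 * m * ?N) ((\<lambda>j. a (2 * j)) ` {..<?N})"
    by (rule obtainable_mono[OF Suc.IH[OF root]]) (auto simp: E_def)
  moreover have "obtainable inp ?R (2 * m * ?N) ((\<lambda>j. a (2 * j + 1)) ` {..<?N})"
    by (rule obtainable_mono[OF Suc.IH[OF root]]) (auto simp: F_def)
  ultimately have "obtainable inp ?R (2 * m * ?N + 2 * m * ?N)
      ((\<lambda>j. a (2 * j)) ` {..<?N} \<union> (\<lambda>j. a (2 * j + 1)) ` {..<?N})"
    by (rule obtainable_Un) simp
  from obtainable_trans[OF halves this refl] show ?case
  proof (rule obtainable_mono)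
    show "a ` {..<2 ^ Suc m} \<subseteq> (\<Union>k<?N. {E k, F k}) \<union>
        ((\<lambda>j. a (2 * j)) ` {..<?N} \<union> (\<lambda>j. a (2 * j + 1)) ` {..<?N})"
      unfolding lessThan_double_parity image_Un image_image by blast
  qed (simp_all add: algebra_simps)
qed

text \<open>
  The degree bounds ensure that the sums over \<open>2\<^sup>m\<close> terms see all coefficients, so that the transforms are
  values of the polynomials at \<open>\<omega>\<^sup>k\<close>, and evaluation is multiplicative.
\<close>

lemma dft_coeff_mult:
  assumes "\<And>e. degree (p e * q e) < 2 ^ m" "\<And>e. degree (p e) < 2 ^ m" "\<And>e. degree (q e) < 2 ^ m"
  shows "dft m \<omega> (\<lambda>j e. coeff (p e * q e) j) k
    = (\<lambda>e. dft m \<omega> (\<lambda>j e. coeff (p e) j) k e * dft m \<omega> (\<lambda>j e. coeff (q e) j) k e)"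
proof -
  have "dft m \<omega> (\<lambda>j e. coeff (r e) j) k e = poly (r e) (\<omega> ^ k)" if "degree (r e) < 2 ^ m"
    for r :: "'a \<Rightarrow> complex poly" and e
  proof -
    have "(\<Sum>j\<le>degree (r e). coeff (r e) j * (\<omega> ^ k) ^ j) = (\<Sum>j<2 ^ m. coeff (r e) j * (\<omega> ^ k) ^ j)"
      using that by (intro sum.mono_neutral_left) (auto simp: coeff_eq_0)
    then show ?thesis
      by (simp add: dft_def poly_altdef mult.commute flip: power_mult)
  qed
  with assms show ?thesis
    by (simp add: fun_eq_iff)
qed

text \<open>
  For \<open>m = 0\<close> the condition is void; otherwise the number \<open>exp (i \<pi> / 2\<^sup>l)\<close> with \<open>l = m - 1\<close> satisfies it.
\<close>

lemma ex_root_of_minus_one: "\<exists>\<omega>::complex. \<forall>l. m = Suc l \<longrightarrow> \<omega> ^ 2 ^ l = - 1"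
  by (rule exI[of _ "cis (pi / 2 ^ (m - 1))"]) (auto simp: DeMoivre)

section \<open>Multiplication by Fourier transforms\<close>

lemma computed_product_circuit:
  assumes "computed (\<lambda>(f, g). coords n f @ coords n g) c S"
    and "\<And>k. k \<le> n \<Longrightarrow> (\<lambda>(f, g). fps_nth (f * g) k) \<in> S"
  shows "\<exists>C. product_circuit n C \<and> circuit_cost C \<le> c"
proof -
  let ?inp = "\<lambda>(f, g). coords n f @ coords n g"
  obtain gs run where gs: "gate_cost gs \<le> c" "\<And>e. run_gates gs (?inp e) = Some (run e)"
    and S: "\<forall>h\<in>S. \<exists>i. \<forall>e. carries (run e) i (h e)"
    using assms(1) unfolding computed_def by blast
  have "\<forall>k\<in>{..n}. \<exists>i. \<forall>f g. carries (run (f, g)) i (fps_nth (f * g) k)"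
  proof
    fix k
    assume "k \<in> {..n}"
    with S assms(2) obtain i where "\<forall>e. carries (run e) i ((\<lambda>(f, g). fps_nth (f * g) k) e)"
      by (meson atMost_iff)
    then show "\<exists>i. \<forall>f g. carries (run (f, g)) i (fps_nth (f * g) k)"
      by auto
  qed
  then obtain out where out: "\<And>k f g. k \<le> n \<Longrightarrow> carries (run (f, g)) (out k) (fps_nth (f * g) k)"
    by (metis atMost_iff)
  have "product_circuit n (Circuit gs (map out [0..<Suc n]))"
    unfolding product_circuit_def
  proof (intro allI)
    fix f g
    from gs(2)[of "(f, g)"] out[of _ f g]
    show "eval_circuit (Circuit gs (map out [0..<Suc n])) (coords n f @ coords n g)
        = Some (coords n (f * g))"
      by (auto simp: eval_circuit_def carries_def coords_def simp del: upt_Suc)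
  qed
  with gs(1) show ?thesis
    by (intro exI[of _ "Circuit gs (map out [0..<Suc n])"]) simp
qed

lemma nth_default_coords [simp]: "nth_default 0 (coords n f) j = (if j \<le> n then fps_nth f j else 0)"
  by (simp add: nth_default_def)

text \<open>
  Two transforms, \<open>2\<^sup>m\<close> pointwise products and one inverse transform cost \<open>6m 2\<^sup>m + 2\<^sup>m\<close>. The truncation in
  \<open>V\<^sub>n\<close> happens at the end, by reading off only the coefficients up to \<open>n\<close> of the full product.
\<close>

lemma ex_product_circuit:
  assumes N: "2 * n < 2 ^ m"
  shows "\<exists>C. product_circuit n C \<and> circuit_cost C \<le> 7 * Suc m * 2 ^ m"
proof -
  let ?inp = "\<lambda>(f, g). coords n f @ coords n g"
  let ?N = "2 ^ m :: nat"
  define p :: "complex fps \<times> complex fps \<Rightarrow> complex poly" where "p = (\<lambda>(f, g). Poly (coords n f))"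
  define q :: "complex fps \<times> complex fps \<Rightarrow> complex poly" where "q = (\<lambda>(f, g). Poly (coords n g))"
  define A where "A = (\<lambda>j e. coeff (p e) j)"
  define B where "B = (\<lambda>j e. coeff (q e) j)"
  define D where "D = (\<lambda>j e. coeff (p e * q e) j)"
  have len: "length (?inp e) = 2 * Suc n" for e
    by (cases e) simp
  obtain \<omega> :: complex where \<omega>: "\<And>l. m = Suc l \<Longrightarrow> \<omega> ^ 2 ^ l = - 1"
    using ex_root_of_minus_one[of m] by metis
  have deg: "degree (p e) \<le> n" "degree (q e) \<le> n" for e
    by (auto simp: p_def q_def split: prod.splits intro!: degree_le)
  have deg_mult: "degree (p e * q e) < ?N" for e
    using degree_mult_le[of "p e" "q e"] deg[of e] N by linarith
  have deg': "degree (p e) < ?N" "degree (q e) < ?N" for e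
    using deg[of e] N by linarith+

  let ?I = "A ` {..n} \<union> B ` {..n}"
  have "computed ?inp 0 ?I"
  proof (rule computed_inputs)
    fix h
    assume "h \<in> ?I"
    then consider k where "k \<le> n" "h = A k" | k where "k \<le> n" "h = B k"
      by auto
    then show "\<exists>i. \<forall>e. carries (?inp e) i (h e)"
    proof cases
      case 1
      then show ?thesis
        by (intro exI[of _ k]) (auto simp: carries_def A_def p_def nth_append)
    next
      case 2
      then show ?thesis
        by (intro exI[of _ "Suc n + k"]) (auto simp: carries_def B_def q_def nth_append)
    qed
  qed
  \<comment> \<open>The coefficients between \<open>n\<close> and \<open>2\<^sup>m\<close> are zero and come from a free constant gate.\<close>
  have zero: "obtainable ?inp ?I 0 {\<lambda>_. 0}"
    by (rule obtainable_gate[OF len, of "Const 0"]) auto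
  have "A j \<in> insert (\<lambda>_. 0) (A ` {..n})" "B j \<in> insert (\<lambda>_. 0) (B ` {..n})" for j
  proof -
    have "A j = (\<lambda>_. 0)" "B j = (\<lambda>_. 0)" if "n < j"
      using that by (auto simp: A_def B_def fun_eq_iff intro!: coeff_eq_0 le_less_trans[OF deg(1)]
          le_less_trans[OF deg(2)])
    then show "A j \<in> insert (\<lambda>_. 0) (A ` {..n})" "B j \<in> insert (\<lambda>_. 0) (B ` {..n})"
      by (cases "j \<le> n"; auto)+
  qed
  then have "A ` {..<?N} \<union> B ` {..<?N} \<subseteq> ?I \<union> {\<lambda>_. 0}"
    by blast
  from obtainable_trans[OF zero obtainable_subset[OF this] refl]
  have "obtainable ?inp ?I 0 (A ` {..<?N} \<union> B ` {..<?N})"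
    by (rule obtainable_mono) auto
  moreover let ?DD = "dft m \<omega> A ` {..<?N} \<union> dft m \<omega> B ` {..<?N}"
  have "obtainable ?inp (A ` {..<?N} \<union> B ` {..<?N}) (2 * m * ?N + 2 * m * ?N) ?DD"
    by (rule obtainable_Un[OF obtainable_mono[OF obtainable_dft[OF len \<omega>, where a = A]]
          obtainable_mono[OF obtainable_dft[OF len \<omega>, where a = B]]]) auto
  ultimately have dfts: "obtainable ?inp ?I (0 + (2 * m * ?N + 2 * m * ?N)) ?DD"
    by (rule obtainable_cut)
  have "obtainable ?inp ?DD 1 {dft m \<omega> D k}" if "k < ?N" for k
    unfolding D_def dft_coeff_mult[OF deg_mult deg'] A_def[symmetric] B_def[symmetric]
    using that by (intro obtainable_arith(4)[OF len]) auto
  then have "obtainable ?inp ?DD (?N * 1) (\<Union>k<?N. {dft m \<omega> D k})"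
    by (rule obtainable_UN)
  also have "(\<Union>k<?N. {dft m \<omega> D k}) = dft m \<omega> D ` {..<?N}"
    by auto
  finally have "obtainable ?inp ?DD (?N * 1 + 2 * m * ?N) (D ` {..<?N})"
    using obtainable_inverse_dft[OF len \<omega>] by (rule obtainable_cut)
  from obtainable_cut[OF dfts this] \<open>computed ?inp 0 ?I\<close>
  have "computed ?inp (0 + (0 + (2 * m * ?N + 2 * m * ?N) + (?N * 1 + 2 * m * ?N)))
      (?I \<union> D ` {..<?N})"
    unfolding obtainable_def by blast
  then have "computed ?inp (7 * Suc m * ?N) (D ` {..<?N})"
    by (rule computed_mono) (auto simp: algebra_simps)
  then show ?thesis
  proof (rule computed_product_circuit)
    fix k
    assume k: "k \<le> n"
    have "(\<lambda>(f, g). fps_nth (f * g) k) = D k"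
      using k by (auto simp: D_def p_def q_def coeff_mult fps_mult_nth
          atLeast0AtMost intro!: sum.cong)
    with k N show "(\<lambda>(f, g). fps_nth (f * g) k) \<in> D ` {..<?N}"
      by auto
  qed
qed

section \<open>Comparison of the costs\<close>

lemma product_cost_attained: "\<exists>C. product_circuit n C \<and> circuit_cost C = product_cost n"
proof -
  have "2 * n < 2 ^ (2 * n)"
    by (rule less_exp)
  from ex_product_circuit[OF this] have "\<exists>c C. product_circuit n C \<and> circuit_cost C = c"
    by blast
  from LeastI_ex[OF this] show ?thesis
    by (simp add: product_cost_def)
qed

lemma product_cost_le: "product_circuit n C \<Longrightarrow> product_cost n \<le> circuit_cost C"
  by (auto simp: product_cost_def intro: Least_le)

lemma product_cost_ge: "n < product_cost n"
  using product_cost_attained[of n] product_circuit_cost_ge by metis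

text \<open>
  Take the power of two with \<open>2n < 2\<^sup>l\<^sup>+\<^sup>1 \<le> 4n\<close>. The product then costs at most \<open>28 n (l + 2)\<close>, and
  \<open>(l + 2) ln 2 \<le> 4 ln n\<close> for \<open>n \<ge> 2\<close>, which explains the constant \<open>112 / ln 2\<close>.
\<close>

lemma product_cost_bigo: "(\<lambda>n. real (product_cost n)) \<in> O(\<lambda>n. real n * ln (real n))"
proof (rule bigoI)
  show "\<forall>\<^sub>F n in sequentially. norm (real (product_cost n)) \<le> 112 / ln 2 * norm (real n * ln (real n))"
    using eventually_ge_at_top[of 2]
  proof eventually_elim
    case (elim n)
    obtain l where l: "2 ^ l \<le> 2 * n" "2 * n < 2 ^ (l + 1)"
      using ex_power_ivl1[of 2 "2 * n"] elim by auto
    from ex_product_circuit[OF l(2)] product_cost_le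
    have "product_cost n \<le> 7 * Suc (l + 1) * 2 ^ (l + 1)"
      by (meson le_trans)
    also have "\<dots> \<le> 7 * Suc (l + 1) * (4 * n)"
      using l(1) by (intro mult_le_mono) auto
    finally have "real (product_cost n) \<le> real (7 * Suc (l + 1) * (4 * n))"
      by (rule of_nat_mono)
    then have cost: "real (product_cost n) \<le> 28 * real n * (real l + 2)"
      by (simp add: algebra_simps)
    have "real (2 ^ l) \<le> real (2 * n)"
      using l(1) by (rule of_nat_mono)
    then have "ln ((2::real) ^ l) \<le> ln (2 * real n)"
      using elim by (subst ln_le_cancel_iff) auto
    then have "real l * ln 2 \<le> ln 2 + ln (real n)"
      using elim by (simp add: ln_realpow ln_mult)
    moreover have "ln 2 \<le> ln (real n)"
      using elim by simp
    ultimately have "(real l + 2) * ln 2 \<le> 4 * ln (real n)"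
      unfolding distrib_right by linarith
    then have "real l + 2 \<le> 4 * ln (real n) / ln 2"
      by (simp add: pos_le_divide_eq)
    then have "28 * real n * (real l + 2) \<le> 28 * real n * (4 * ln (real n) / ln 2)"
      by (intro mult_left_mono) auto
    with cost show ?case
      using elim by simp
  qed
qed

lemma n_product_cost_bigo:
  "(\<lambda>n. real n * real (product_cost n)) \<in> O(\<lambda>n. real n ^ 2 * ln (real n))"
  using landau_o.big.mult_left[OF product_cost_bigo, of real]
  by (simp add: power2_eq_square mult.assoc)

lemma power_cost_bigo:
  "(\<lambda>n. real (3 * n + 1 + (n - 1) * product_cost n)) \<in> O(\<lambda>n. real n * real (product_cost n))"
proof (rule bigoI)
  show "\<forall>\<^sub>F n in sequentially. norm (real (3 * n + 1 + (n - 1) * product_cost n))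
      \<le> 5 * norm (real n * real (product_cost n))"
    using eventually_ge_at_top[of 1]
  proof eventually_elim
    case (elim n)
    have "n * 1 \<le> n * product_cost n"
      using product_cost_ge[of n] by (intro mult_le_mono) auto
    moreover have "(n - 1) * product_cost n \<le> n * product_cost n"
      by simp
    ultimately have "3 * n + 1 + (n - 1) * product_cost n \<le> 5 * (n * product_cost n)"
      using elim by linarith
    then have "real (3 * n + 1 + (n - 1) * product_cost n) \<le> real (5 * (n * product_cost n))"
      by (rule of_nat_mono)
    then show ?case
      by simp
  qed
qed

text \<open>
  With \<open>c \<ge> n + 1\<close> the right-hand side is at least \<open>n\<^sup>2 + 3n\<close>, and the left-hand side is \<open>n\<^sup>2 + n\<close>.
\<close>

lemma recurrence_cost_less:
  assumes "n \<ge> 1" "n < c"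
  shows "n * Suc n < 3 * n + 1 + (n - 1) * c"
proof -
  obtain l where n: "n = Suc l"
    using assms(1) by (cases n) auto
  have "l * Suc (Suc l) \<le> l * c"
    using assms(2) n by (intro mult_le_mono) auto
  then show ?thesis
    by (simp add: n)
qed

lemma recurrence_cost_bigtheta: "(\<lambda>n. real (n * Suc n)) \<in> \<Theta>(\<lambda>n. real n ^ 2)"
proof (rule bigthetaI')
  show "\<forall>\<^sub>F n in sequentially. 1 * norm (real n ^ 2) \<le> norm (real (n * Suc n)) \<and>
      norm (real (n * Suc n)) \<le> 2 * norm (real n ^ 2)"
    using eventually_ge_at_top[of 1]
  proof eventually_elim
    case (elim n)
    then have "n * Suc n \<le> 2 * (n * n)"
      by simp
    then have "real (n * Suc n) \<le> real (2 * (n * n))"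
      by (rule of_nat_mono)
    moreover have "real (n * n) \<le> real (n * Suc n)"
      by (rule of_nat_mono) simp
    ultimately show ?case
      by (simp add: power2_eq_square del: mult_Suc_right)
  qed
qed simp_all

theorem corollary5:
  shows
    "(\<forall>n. coords n (nilp ^ Suc n) = coords n 0) \<and>
     (\<forall>k. Abs_fps (\<lambda>n. of_nat (Stirling n k) / fact n) = fps_const (1 / fact k) * nilp ^ k) \<and>
     (\<forall>n. \<exists>C. product_circuit n C \<and> circuit_cost C = product_cost n) \<and>
     (\<forall>mul. (\<forall>n. product_circuit n (mul n) \<and> circuit_cost (mul n) = product_cost n) \<longrightarrow>
        (\<forall>n. eval_circuit (stirling_by_powers (mul n) n) [] = Some (stirling_numbers n)) \<and>
        (\<lambda>n. real (circuit_cost (stirling_by_powers (mul n) n)))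
          \<in> O(\<lambda>n. real n * real (product_cost n)) \<and>
        (\<lambda>n. real (circuit_cost (stirling_by_powers (mul n) n)))
          \<in> O(\<lambda>n. real n ^ 2 * ln (real n)) \<and>
        (\<forall>n\<ge>1. circuit_cost (stirling_by_recurrence n)
                < circuit_cost (stirling_by_powers (mul n) n))) \<and>
     (\<lambda>n. real n * real (product_cost n)) \<in> O(\<lambda>n. real n ^ 2 * ln (real n)) \<and>
     (\<forall>n. eval_circuit (stirling_by_recurrence n) [] = Some (stirling_numbers n)) \<and>
     (\<lambda>n. real (circuit_cost (stirling_by_recurrence n))) \<in> \<Theta>(\<lambda>n. real n ^ 2)"
proof (intro conjI allI impI)
  fix n
  show "coords n (nilp ^ Suc n) = coords n 0"
    by (rule coords_nilp_power)
next
  fix k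
  show "Abs_fps (\<lambda>n. of_nat (Stirling n k) / fact n) = fps_const (1 / fact k) * nilp ^ k"
    by (rule stirling_egf)
next
  fix n
  show "\<exists>C. product_circuit n C \<and> circuit_cost C = product_cost n"
    by (rule product_cost_attained)
next
  fix mul n
  assume "\<forall>n. product_circuit n (mul n) \<and> circuit_cost (mul n) = product_cost n"
  then show "eval_circuit (stirling_by_powers (mul n) n) [] = Some (stirling_numbers n)"
    by (intro stirling_by_powers_correct) simp
next
  fix mul :: "nat \<Rightarrow> circuit"
  assume mul: "\<forall>n. product_circuit n (mul n) \<and> circuit_cost (mul n) = product_cost n"
  then have cost: "circuit_cost (stirling_by_powers (mul n) n) = 3 * n + 1 + (n - 1) * product_cost n"
    for n
    using stirling_by_powers_correct(2)[of n "mul n"] by simp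
  show "(\<lambda>n. real (circuit_cost (stirling_by_powers (mul n) n)))
      \<in> O(\<lambda>n. real n * real (product_cost n))"
    unfolding cost by (rule power_cost_bigo)
  then show "(\<lambda>n. real (circuit_cost (stirling_by_powers (mul n) n)))
      \<in> O(\<lambda>n. real n ^ 2 * ln (real n))"
    using n_product_cost_bigo by (rule landau_o.big_trans)
  show "circuit_cost (stirling_by_recurrence n) < circuit_cost (stirling_by_powers (mul n) n)"
    if "n \<ge> 1" for n
    unfolding cost stirling_by_recurrence_correct(2)
    using that product_cost_ge by (rule recurrence_cost_less)
next
  show "(\<lambda>n. real n * real (product_cost n)) \<in> O(\<lambda>n. real n ^ 2 * ln (real n))"
    by (rule n_product_cost_bigo)
next
  fix n
  show "eval_circuit (stirling_by_recurrence n) [] = Some (stirling_numbers n)"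
    by (rule stirling_by_recurrence_correct)
next
  show "(\<lambda>n. real (circuit_cost (stirling_by_recurrence n))) \<in> \<Theta>(\<lambda>n. real n ^ 2)"
    unfolding stirling_by_recurrence_correct(2) by (rule recurrence_cost_bigtheta)
qed

end
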